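(* Let $X_1$ and $X_2$ be random variables with continuous distribution functions $F_1$ and $F_2$ and densities $f_1$ and $f_2$ respectively. Let $U_1,\dots,U_n$ be mutually independent random variables with $U_i\sim Kw\text{-}G(\alpha_i,\beta_i,F_1)$, and let $V_1,\dots,V_n$ be mutually independent random variables with $V_i\sim Kw\text{-}G(\gamma_i,\beta_i,F_2)$, $i=1,\dots,n$. Write $\boldsymbol\alpha=(\alpha_1,\dots,\alpha_n)$, $\boldsymbol\beta=(\beta_1,\dots,\beta_n)$, $\boldsymbol\gamma=(\gamma_1,\dots,\gamma_n)$, and suppose that $\boldsymbol\alpha,\boldsymbol\gamma\in\mathcal{D}_+$, $\boldsymbol\beta\in\mathcal{E}_+$ and $\boldsymbol\alpha\stackrel{m}{\succeq}\boldsymbol\gamma$. Then $X_1\le_{st}X_2$ implies $U_{1:n}\le_{st}V_{1:n}$.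
   Context: For $\alpha,\beta>0$ and a distribution function $F$, $X\sim Kw\text{-}G(\alpha,\beta,F)$ means that $X$ has distribution function $x\mapsto 1-(1-F^{\alpha}(x))^{\beta}$, $x\in\mathbb{R}$, where $F^\alpha(x)=(F(x))^\alpha$. $U_{1:n}=\min(U_1,\dots,U_n)$ and $V_{1:n}=\min(V_1,\dots,V_n)$. $\mathcal{D}_+=\{(x_1,\dots,x_n): x_1\ge x_2\ge\cdots\ge x_n>0\}$ and $\mathcal{E}_+=\{(x_1,\dots,x_n): 0<x_1\le x_2\le\cdots\le x_n\}$. For real vectors $\mathbf{x},\mathbf{y}$ of length $n$ with increasing rearrangements $x_{(1)}\le\cdots\le x_{(n)}$ and $y_{(1)}\le\cdots\le y_{(n)}$, $\mathbf{x}\stackrel{m}{\succeq}\mathbf{y}$ ($\mathbf{x}$ majorizes $\mathbf{y}$) means $\sum_{i=1}^j x_{(i)}\le\sum_{i=1}^j y_{(i)}$ for $j=1,\dots,n-1$ and $\sum_{i=1}^n x_{(i)}=\sum_{i=1}^n y_{(i)}$. Usual stochastic order: $X\le_{st}Y$ means $F_X(t)\ge F_Y(t)$ for all $t$, where $F_X,F_Y$ are the distribution functions of $X,Y$. *)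

theory Defs
  imports "HOL-Probability.Probability"
begin

text \<open>Vectors of length \<open>n\<close> are functions \<open>nat \<Rightarrow> real\<close> of which only the values at the indices
  \<open>1, \<dots>, n\<close> matter.\<close>

definition dist_fun :: "'a measure \<Rightarrow> ('a \<Rightarrow> real) \<Rightarrow> real \<Rightarrow> real" where
  "dist_fun M X = cdf (distr M borel X)"

text \<open>The order compares laws only, so the two variables may live on different probability
  spaces.\<close>

definition st_le :: "'a measure \<Rightarrow> ('a \<Rightarrow> real) \<Rightarrow> 'b measure \<Rightarrow> ('b \<Rightarrow> real) \<Rightarrow> bool" where
  "st_le M X N Y \<longleftrightarrow> (\<forall>t. dist_fun M X t \<ge> dist_fun N Y t)"

text \<open>For \<open>a, b > 0\<close> the convention \<open>0 powr a = 0\<close> gives the intended value at the points where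
  \<open>F x\<close> is \<open>0\<close> or \<open>1\<close>.\<close>

definition Kw_G :: "'a measure \<Rightarrow> ('a \<Rightarrow> real) \<Rightarrow> real \<Rightarrow> real \<Rightarrow> (real \<Rightarrow> real) \<Rightarrow> bool" where
  "Kw_G M X a b F \<longleftrightarrow> X \<in> borel_measurable M \<and>
     (\<forall>x. dist_fun M X x = 1 - (1 - F x powr a) powr b)"

definition min_stat :: "nat \<Rightarrow> (nat \<Rightarrow> 'a \<Rightarrow> real) \<Rightarrow> 'a \<Rightarrow> real" where
  "min_stat n U \<omega> = Min ((\<lambda>i. U i \<omega>) ` {1..n})"

definition D_plus :: "nat \<Rightarrow> (nat \<Rightarrow> real) set" where
  "D_plus n = {x. (\<forall>i\<in>{1..n}. \<forall>j\<in>{1..n}. i \<le> j \<longrightarrow> x i \<ge> x j) \<and> (\<forall>i\<in>{1..n}. x i > 0)}"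

definition E_plus :: "nat \<Rightarrow> (nat \<Rightarrow> real) set" where
  "E_plus n = {x. (\<forall>i\<in>{1..n}. \<forall>j\<in>{1..n}. i \<le> j \<longrightarrow> x i \<le> x j) \<and> (\<forall>i\<in>{1..n}. x i > 0)}"

text \<open>\<open>incr_rearr n x i\<close> is the \<open>i\<close>-th smallest entry, counted from \<open>1\<close> and with multiplicity.\<close>

definition incr_rearr :: "nat \<Rightarrow> (nat \<Rightarrow> real) \<Rightarrow> nat \<Rightarrow> real" where
  "incr_rearr n x i = sort (map x [1..<Suc n]) ! (i - 1)"

definition majorizes :: "nat \<Rightarrow> (nat \<Rightarrow> real) \<Rightarrow> (nat \<Rightarrow> real) \<Rightarrow> bool" where
  "majorizes n x y \<longleftrightarrow>
     (\<forall>j\<in>{1..<n}. (\<Sum>i=1..j. incr_rearr n x i) \<le> (\<Sum>i=1..j. incr_rearr n y i)) \<and>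
     (\<Sum>i=1..n. incr_rearr n x i) = (\<Sum>i=1..n. incr_rearr n y i)"

end

theory Submission
  imports Defs
begin

text \<open>The survival function of a minimum of independent \<open>Kw_G\<close> variables is
  \<open>\<Prod>i. (1 - u powr \<alpha> i) powr \<beta> i\<close> with \<open>u = F t\<close>. It is antitone in \<open>u\<close>, so it suffices to
  compare \<open>\<alpha>\<close> and \<open>\<gamma>\<close> at one \<open>u\<close>. The logarithm of the \<open>i\<close>-th factor is concave in the exponent, so
  the difference of the logarithms is at most \<open>\<Sum>i. w i * (\<alpha> i - \<gamma> i)\<close>, where \<open>w i\<close> is \<open>\<beta> i\<close> times
  the slope at \<open>\<gamma> i\<close>. Both of these factors are nonnegative and increase with \<open>i\<close>, so Abel summation
  against the tail sums, which majorization makes nonpositive, shows that this sum is nonpositive.\<close>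

text \<open>Abel summation as a downward induction on the lower index: after the term
  \<open>w k * d k\<close> is split off, the weight \<open>w (Suc k)\<close> is lowered to
  \<open>w k\<close>, which can only increase its product with a nonpositive tail sum.\<close>

lemma sum_mult_le_tail:
  fixes w d :: "nat \<Rightarrow> 'a :: linordered_idom"
  assumes w: "\<And>i j. m \<le> i \<Longrightarrow> i \<le> j \<Longrightarrow> j \<le> n \<Longrightarrow> w i \<le> w j"
    and tail: "\<And>k. m < k \<Longrightarrow> k \<le> n \<Longrightarrow> (\<Sum>i=k..n. d i) \<le> 0"
    and "m \<le> n"
  shows "(\<Sum>i=m..n. w i * d i) \<le> w m * (\<Sum>i=m..n. d i)"
  using \<open>m \<le> n\<close>
proof (induction rule: inc_induct)
  case base
  show ?case by simp
next
  case (step k)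
  have "w (Suc k) * (\<Sum>i=Suc k..n. d i) \<le> w k * (\<Sum>i=Suc k..n. d i)"
    using step by (intro mult_right_mono_neg w tail) auto
  with step show ?case
    by (simp add: sum.atLeast_Suc_atMost algebra_simps)
qed

text \<open>A decreasing list is sorted by reversing it; indices counted from 1 turn this into the
  reflection \<open>Suc n - i\<close>.\<close>

lemma incr_rearr_D_plus:
  assumes x: "x \<in> D_plus n" and i: "i \<in> {1..n}"
  shows "incr_rearr n x i = x (Suc n - i)"
proof -
  have "sorted (rev (map x [1..<Suc n]))"
    using x by (auto simp: sorted_rev_iff_nth_mono D_plus_def nth_append simp del: upt_Suc)
  then have "sort (map x [1..<Suc n]) = rev (map x [1..<Suc n])"
    by (metis properties_for_sort mset_rev)
  with i show ?thesis
    by (auto simp: incr_rearr_def rev_nth Suc_diff_le simp del: upt_Suc)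
qed

lemma sum_incr_rearr_D_plus:
  assumes x: "x \<in> D_plus n" and k: "k \<in> {1..n}"
  shows "(\<Sum>i=1..Suc n - k. incr_rearr n x i) = (\<Sum>i=k..n. x i)"
  using k
  by (intro sum.reindex_bij_witness[of _ "\<lambda>i. Suc n - i" "\<lambda>i. Suc n - i"])
     (auto simp: incr_rearr_D_plus[OF x])

text \<open>For decreasing vectors the smallest entries come last, so the partial sums in
  \<open>majorizes\<close> are tail sums. The case \<open>k = 1\<close> is separate because it
  concerns the full sum, for which majorization gives an equality.\<close>

lemma majorizes_D_plus:
  assumes "x \<in> D_plus n" "y \<in> D_plus n" "majorizes n x y" "k \<in> {1..n}"
  shows "(\<Sum>i=k..n. x i) \<le> (\<Sum>i=k..n. y i)"
proof (cases "k = 1")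
  case True
  then show ?thesis
    using assms sum_incr_rearr_D_plus[of x n 1] sum_incr_rearr_D_plus[of y n 1]
    by (simp add: majorizes_def)
next
  case False
  then have "Suc n - k \<in> {1..<n}" using assms(4) by auto
  then have "(\<Sum>i=1..Suc n - k. incr_rearr n x i) \<le> (\<Sum>i=1..Suc n - k. incr_rearr n y i)"
    using assms(3) unfolding majorizes_def by blast
  then show ?thesis
    using assms by (simp only: sum_incr_rearr_D_plus)
qed

lemma (in prob_space) dist_fun_min_stat:
  assumes n: "n \<ge> 1" and ind: "indep_vars (\<lambda>_. borel) U {1..n}"
  shows "dist_fun M (min_stat n U) t = 1 - (\<Prod>i=1..n. 1 - dist_fun M (U i) t)"
proof -
  have U[measurable]: "random_variable borel (U i)" if "i \<in> {1..n}" for i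
    using ind that by (auto simp: indep_vars_def)
  have min[measurable]: "random_variable borel (min_stat n U)"
    unfolding min_stat_def by (rule borel_measurable_Min) (auto intro: U)
  have ge: "prob (U i -` {t<..} \<inter> space M) = 1 - dist_fun M (U i) t" if "i \<in> {1..n}" for i
  proof -
    have "U i -` {t<..} \<inter> space M = space M - U i -` {..t} \<inter> space M" by auto
    then show ?thesis
      using prob_compl[OF measurable_sets[OF U[OF that], of "{..t}"]]
      by (simp add: dist_fun_def cdf_def measure_distr U[OF that] Diff_Int)
  qed
  \<comment> \<open>As the index set is nonempty, the minimum exceeds \<open>t\<close> exactly when
    every \<open>U i\<close> does; independence then turns the intersection into a product.\<close>
  have "min_stat n U -` {t<..} \<inter> space M = (\<Inter>i\<in>{1..n}. U i -` {t<..} \<inter> space M)"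
    using n by (auto simp: min_stat_def)
  then have "prob (min_stat n U -` {t<..} \<inter> space M) = (\<Prod>i=1..n. prob (U i -` {t<..} \<inter> space M))"
    using n by (simp only:) (intro indep_varsD_finite[OF ind], auto)
  also have "\<dots> = (\<Prod>i=1..n. 1 - dist_fun M (U i) t)"
    by (simp add: ge)
  moreover have "min_stat n U -` {t<..} \<inter> space M = space M - min_stat n U -` {..t} \<inter> space M"
    by auto
  ultimately show ?thesis
    using prob_compl[OF measurable_sets[OF min, of "{..t}"]]
    by (simp add: dist_fun_def cdf_def measure_distr min Diff_Int)
qed

text \<open>This is the tangent bound at \<open>c\<close> for the concave map sending
  \<open>a\<close> to \<open>ln (1 - u powr a)\<close>. No derivative is taken:
  \<open>ln x \<le> x - 1\<close> bounds the logarithm of the quotient, and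
  \<open>1 + x \<le> exp x\<close> bounds \<open>1 - u powr (a - c)\<close>.\<close>

lemma ln_one_minus_powr_tangent:
  fixes u a c :: real
  assumes "0 < u" "u < 1" "0 < a" "0 < c"
  shows "ln (1 - u powr a) - ln (1 - u powr c) \<le> - ln u * (u powr c / (1 - u powr c)) * (a - c)"
proof -
  have pos: "1 - u powr a > 0" "1 - u powr c > 0"
    using assms by (auto simp: powr01_less_one)
  have "ln (1 - u powr a) - ln (1 - u powr c) = ln ((1 - u powr a) / (1 - u powr c))"
    using pos by (simp add: ln_div)
  also have "\<dots> \<le> (1 - u powr a) / (1 - u powr c) - 1"
    using pos by (intro ln_le_minus_one) auto
  also have "\<dots> = u powr c / (1 - u powr c) * (1 - u powr (a - c))"
    using assms pos by (simp add: powr_diff field_simps)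
  also have "\<dots> \<le> u powr c / (1 - u powr c) * (- ln u * (a - c))"
    using assms pos exp_ge_add_one_self[of "(a - c) * ln u"]
    by (intro mult_left_mono) (auto simp: powr_def algebra_simps)
  finally show ?thesis by (simp only: mult_ac)
qed

lemma prod_one_minus_powr_majorizes:
  fixes u :: real
  assumes n: "n \<ge> 1" and u: "0 \<le> u" "u \<le> 1"
    and \<alpha>: "\<alpha> \<in> D_plus n" and \<gamma>: "\<gamma> \<in> D_plus n" and \<beta>: "\<beta> \<in> E_plus n"
    and maj: "majorizes n \<alpha> \<gamma>"
  shows "(\<Prod>i=1..n. (1 - u powr \<alpha> i) powr \<beta> i) \<le> (\<Prod>i=1..n. (1 - u powr \<gamma> i) powr \<beta> i)"
proof -
  consider "u = 0" | "u = 1" | "0 < u" "u < 1" using u by fastforce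
  then show ?thesis
  proof cases
    case 3
    define s where "s i = - ln u * (u powr \<gamma> i / (1 - u powr \<gamma> i))" for i
    define w where "w i = \<beta> i * s i" for i
    have pos: "\<alpha> i > 0" "\<gamma> i > 0" "\<beta> i > 0" "u powr \<alpha> i < 1" "u powr \<gamma> i < 1"
      if "i \<in> {1..n}" for i
      using that \<alpha> \<gamma> \<beta> 3 by (auto simp: D_plus_def E_plus_def powr01_less_one)
    \<comment> \<open>The exponential form requires a nonzero base, since \<open>0 powr b\<close> is
      \<open>0\<close> by convention.\<close>
    have prod_eq: "(\<Prod>i=1..n. (1 - u powr x i) powr \<beta> i) = exp (\<Sum>i=1..n. \<beta> i * ln (1 - u powr x i))"
      if "x = \<alpha> \<or> x = \<gamma>" for x
      unfolding exp_sum[OF finite_atLeastAtMost]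
    proof (rule prod.cong)
      fix i assume "i \<in> {1..n}"
      then have "1 - u powr x i \<noteq> 0" using that pos[of i] by auto
      then show "(1 - u powr x i) powr \<beta> i = exp (\<beta> i * ln (1 - u powr x i))"
        by (simp only: powr_def if_False)
    qed simp
    have s_nonneg: "0 \<le> s i" if "i \<in> {1..n}" for i
      using pos[OF that] 3 unfolding s_def by (intro mult_nonneg_nonneg) auto
    have w_mono: "w i \<le> w j" if "1 \<le> i" "i \<le> j" "j \<le> n" for i j
    proof -
      have ij: "i \<in> {1..n}" "j \<in> {1..n}" using that by auto
      have "\<gamma> j \<le> \<gamma> i" "\<beta> i \<le> \<beta> j"
        using that ij \<gamma> \<beta> by (auto simp: D_plus_def E_plus_def)
      \<comment> \<open>As \<open>u < 1\<close>, the smaller exponent gives the larger power; the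
        slope inherits this order because p / (1 - p) increases on [0, 1) and \<open>- ln u\<close>
        is positive.\<close>
      moreover from this have "u powr \<gamma> i \<le> u powr \<gamma> j"
        using 3 by (intro powr_mono') auto
      then have "s i \<le> s j"
        unfolding s_def using 3 pos[OF ij(1)] pos[OF ij(2)]
        by (intro mult_left_mono frac_le) auto
      ultimately show ?thesis
        unfolding w_def using pos[OF ij(2)] s_nonneg[OF ij(1)] by (intro mult_mono) auto
    qed
    have tail: "(\<Sum>i=k..n. \<alpha> i - \<gamma> i) \<le> 0" if "k \<in> {1..n}" for k
      using majorizes_D_plus[OF \<alpha> \<gamma> maj that] by (simp add: sum_subtractf)
    have "(\<Sum>i=1..n. \<beta> i * ln (1 - u powr \<alpha> i)) - (\<Sum>i=1..n. \<beta> i * ln (1 - u powr \<gamma> i))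
        = (\<Sum>i=1..n. \<beta> i * (ln (1 - u powr \<alpha> i) - ln (1 - u powr \<gamma> i)))"
      by (simp add: sum_subtractf right_diff_distrib)
    also have "\<dots> \<le> (\<Sum>i=1..n. w i * (\<alpha> i - \<gamma> i))"
      unfolding w_def s_def mult.assoc[of "\<beta> _"] using 3 pos
      by (intro sum_mono mult_left_mono ln_one_minus_powr_tangent) (auto intro: less_imp_le)
    also have "\<dots> \<le> w 1 * (\<Sum>i=1..n. \<alpha> i - \<gamma> i)"
      using n w_mono tail by (intro sum_mult_le_tail) auto
    also have "\<dots> \<le> 0"
      using n tail[of 1] pos[of 1] s_nonneg[of 1] by (intro mult_nonneg_nonpos) (auto simp: w_def)
    finally show ?thesis by (simp add: prod_eq del: One_nat_def)
  \<comment> \<open>At the endpoints the two products agree: all factors are 1 for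
    \<open>u = 0\<close> and 0 for \<open>u = 1\<close>.\<close>
  qed (use n in auto)
qed

lemma prod_one_minus_powr_antimono:
  fixes u v :: real
  assumes "0 \<le> u" "u \<le> v" "v \<le> 1"
    and c: "\<And>i. i \<in> I \<Longrightarrow> 0 \<le> c i" and b: "\<And>i. i \<in> I \<Longrightarrow> 0 \<le> b i"
  shows "(\<Prod>i\<in>I. (1 - v powr c i) powr b i) \<le> (\<Prod>i\<in>I. (1 - u powr c i) powr b i)"
  using assms by (intro prod_mono conjI powr_mono2) (auto intro!: powr_mono2 powr_le1)

theorem theorem4p1:
  fixes M1 :: "'a measure" and M2 :: "'b measure" and M :: "'c measure" and N :: "'d measure"
    and X1 :: "'a \<Rightarrow> real" and X2 :: "'b \<Rightarrow> real"
    and U :: "nat \<Rightarrow> 'c \<Rightarrow> real" and V :: "nat \<Rightarrow> 'd \<Rightarrow> real"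
    and F1 F2 :: "real \<Rightarrow> real" and f1 f2 :: "real \<Rightarrow> ennreal"
    and \<alpha> \<beta> \<gamma> :: "nat \<Rightarrow> real" and n :: nat
  assumes "prob_space M1" and "prob_space M2" and "prob_space M" and "prob_space N"
    and "n \<ge> 1"
    and "X1 \<in> borel_measurable M1" and "X2 \<in> borel_measurable M2"
    and "F1 = dist_fun M1 X1" and "F2 = dist_fun M2 X2"
    and "continuous_on UNIV F1" and "continuous_on UNIV F2"
    and "distributed M1 lborel X1 f1" and "distributed M2 lborel X2 f2"
    and "prob_space.indep_vars M (\<lambda>_. borel) U {1..n}"
    and "\<And>i. i \<in> {1..n} \<Longrightarrow> Kw_G M (U i) (\<alpha> i) (\<beta> i) F1"
    and "prob_space.indep_vars N (\<lambda>_. borel) V {1..n}"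
    and "\<And>i. i \<in> {1..n} \<Longrightarrow> Kw_G N (V i) (\<gamma> i) (\<beta> i) F2"
    and "\<alpha> \<in> D_plus n" and "\<gamma> \<in> D_plus n" and "\<beta> \<in> E_plus n"
    and "majorizes n \<alpha> \<gamma>"
    and "st_le M1 X1 M2 X2"
  shows "st_le M (min_stat n U) N (min_stat n V)"
  unfolding st_le_def
proof
  fix t
  interpret M1: prob_space M1 by fact
  interpret M2: prob_space M2 by fact
  interpret M: prob_space M by fact
  interpret N: prob_space N by fact
  interpret D1: prob_space "distr M1 borel X1" by (rule M1.prob_space_distr) fact
  interpret D2: prob_space "distr M2 borel X2" by (rule M2.prob_space_distr) fact
  have F: "0 \<le> F2 t" "F2 t \<le> F1 t" "0 \<le> F1 t" "F1 t \<le> 1"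
    using assms(22) by (auto simp: assms(8,9) st_le_def dist_fun_def cdf_def)
  \<comment> \<open>The passage from \<open>V\<close> to \<open>U\<close> has two stages: first the
    base grows from \<open>F2 t\<close> to \<open>F1 t\<close> with the exponents
    \<open>\<gamma>\<close> fixed, then \<open>\<gamma>\<close> is replaced by
    \<open>\<alpha>\<close> at the base \<open>F1 t\<close>.\<close>
  have "dist_fun N (min_stat n V) t = 1 - (\<Prod>i=1..n. (1 - F2 t powr \<gamma> i) powr \<beta> i)"
    using assms(17) by (simp add: N.dist_fun_min_stat[OF assms(5,16)] Kw_G_def)
  also have "\<dots> \<le> 1 - (\<Prod>i=1..n. (1 - F1 t powr \<gamma> i) powr \<beta> i)"
    using F assms(19,20)
    by (intro diff_left_mono prod_one_minus_powr_antimono)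
       (auto simp: D_plus_def E_plus_def less_imp_le)
  also have "\<dots> \<le> 1 - (\<Prod>i=1..n. (1 - F1 t powr \<alpha> i) powr \<beta> i)"
    using F assms by (intro diff_left_mono prod_one_minus_powr_majorizes)
  also have "\<dots> = dist_fun M (min_stat n U) t"
    using assms(15) by (simp add: M.dist_fun_min_stat[OF assms(5,14)] Kw_G_def)
  finally show "dist_fun N (min_stat n V) t \<le> dist_fun M (min_stat n U) t" .
qed

end
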